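(* For $t \ge 1$ let $B^*_t(q) := \sum_{n \geq 1} b^*_t(n) q^n$, where $b^*_t(n) := \sum_{\lambda \in \mathcal{DO}(n)} n_t(\lambda)$. Then, as formal power series in $q$: for $t \geq 2$ even, \begin{align*} B^*_t(q) &= (-q; q^2)_\infty \sum_{k = 0}^{\lfloor (t-4)/6 \rfloor} q^{t+4k^2+2k} \binom{\frac{t-2k-2}{2}}{2k+1}_{q^2} \sum_{m \geq 0} \frac{q^{2m(2k+2)}}{(-q^{2m+1}; q^2)_{\frac{t-2k}{2}}} \\ &\quad+ (-q; q^2)_\infty \sum_{k=0}^{\lfloor (t-2)/6 \rfloor} q^{t+ 4k^2 + 2k + 1} \binom{\frac{t-2k-2}{2}}{2k}_{q^2} \sum_{m \geq 0} \frac{q^{2m(2k+1)}}{(-q^{2m+3}; q^2)_{\frac{t-2k}{2}}}, \end{align*} and for $t \geq 1$ odd, \begin{align*} B^*_t(q) &= (-q; q^2)_\infty \sum_{k = 0}^{\lfloor (t-1)/6 \rfloor} q^{t+4k^2-2k} \binom{\frac{t-2k-1}{2}}{2k}_{q^2} \sum_{m \geq 0} \frac{q^{2m(2k+1)}}{(-q^{2m+1}; q^2)_{\frac{t-2k+1}{2}}} \\ &\quad+ (-q; q^2)_\infty \sum_{k=0}^{\lfloor (t-5)/6 \rfloor} q^{t+ 4k^2 + 6k + 3} \binom{\frac{t-2k-3}{2}}{2k+1}_{q^2} \sum_{m \geq 0} \frac{q^{2m(2k+2)}}{(-q^{2m+3}; q^2)_{\frac{t-2k-1}{2}}}. \end{align*}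 (Empty sums are $0$.)
   Context: A partition $\lambda$ of $n$ is a non-increasing sequence of positive integers summing to $n$, drawn as a Ferrers–Young diagram of left-justified rows. The hook number of a box is the number of boxes to its right in its row, plus the number of boxes below it in its column, plus one. $n_t(\lambda)$ is the number of boxes of $\lambda$ with hook number exactly $t$; $\mathcal{DO}(n)$ is the set of partitions of $n$ into distinct odd parts. Notation: $(x;q)_0 := 1$, $(x;q)_n := \prod_{i=0}^{n-1}(1-xq^i)$, $(x;q)_\infty := \lim_{n\to\infty}(x;q)_n$, and the $q$-binomial coefficient is $\binom{n}{k}_q := \frac{(q;q)_n}{(q;q)_k (q;q)_{n-k}}$ for $0\le k\le n$ (and $0$ if $k > n$). *)

theory Defs
  imports "HOL-Computational_Algebra.Formal_Power_Series"
begin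

definition is_partition :: "nat list \<Rightarrow> nat \<Rightarrow> bool" where
  "is_partition lam n \<longleftrightarrow>
     sorted_wrt (\<ge>) lam \<and> (\<forall>p\<in>set lam. p > 0) \<and> sum_list lam = n"

text \<open>Rows and columns are counted from \<open>0\<close>: the box \<open>(i, j)\<close> is in row \<open>i\<close> and column \<open>j\<close>.\<close>

definition boxes :: "nat list \<Rightarrow> (nat \<times> nat) set" where
  "boxes lam = {(i, j). i < length lam \<and> j < lam ! i}"

definition hook_number :: "nat list \<Rightarrow> nat \<times> nat \<Rightarrow> nat" where
  "hook_number lam = (\<lambda>(i, j).
     card {j'. j < j' \<and> (i, j') \<in> boxes lam} + card {i'. i < i' \<and> (i', j) \<in> boxes lam} + 1)"

definition hook_count :: "nat \<Rightarrow> nat list \<Rightarrow> nat" where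
  "hook_count t lam = card {b \<in> boxes lam. hook_number lam b = t}"

definition DO :: "nat \<Rightarrow> nat list set" where
  "DO n = {lam. is_partition lam n \<and> distinct lam \<and> (\<forall>p\<in>set lam. odd p)}"

lemma finite_DO: "finite (DO n)"
proof (rule finite_subset)
  have len: "length lam \<le> sum_list lam" if "\<forall>p\<in>set lam. p > 0" for lam :: "nat list"
    using that by (induction lam) (auto simp: Suc_le_eq)
  show "DO n \<subseteq> {lam. set lam \<subseteq> {..n} \<and> length lam \<le> n}"
    using len member_le_sum_list by (fastforce simp: DO_def is_partition_def)
  show "finite {lam. set lam \<subseteq> {..n} \<and> length lam \<le> n}"
    by (rule finite_lists_length_le) simp
qed

definition b_star :: "nat \<Rightarrow> nat \<Rightarrow> nat" where
  "b_star t n = (\<Sum>lam\<in>DO n. hook_count t lam)"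

definition B_star :: "nat \<Rightarrow> rat fps" where
  "B_star t = Abs_fps (\<lambda>n. if n \<ge> 1 then of_nat (b_star t n) else 0)"

definition q_poch :: "'a::comm_ring_1 \<Rightarrow> 'a \<Rightarrow> nat \<Rightarrow> 'a" where
  "q_poch x q n = (\<Prod>i<n. 1 - x * q ^ i)"

text \<open>The limit is taken in the metric topology of \<^typ>\<open>'a fps\<close>, which is coefficientwise
  convergence; the same holds for infinite sums of power series.\<close>

definition q_poch_inf :: "'a::comm_ring_1 fps \<Rightarrow> 'a fps \<Rightarrow> 'a fps" where
  "q_poch_inf x q = lim (\<lambda>n. q_poch x q n)"

definition q_binom :: "nat \<Rightarrow> nat \<Rightarrow> 'a::field fps \<Rightarrow> 'a fps" where
  "q_binom n k q =
     (if k \<le> n then q_poch q q n / (q_poch q q k * q_poch q q (n - k)) else 0)"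

end

theory Submission
  imports Defs
begin

text \<open>A partition into distinct odd parts is a finite set \<open>S\<close> of odd numbers, and a box of hook number
  \<open>t\<close> amounts to a column \<open>j\<close> and a number \<open>l < t\<close> such that \<open>p = j + (t - l)\<close> lies in \<open>S\<close> and exactly
  \<open>l\<close> elements of \<open>S\<close> lie strictly between \<open>j\<close> and \<open>p\<close>. For fixed \<open>j\<close> and \<open>l\<close> the generating function
  of such \<open>S\<close> is a product: the odd numbers outside \<open>(j, p]\<close> are free, \<open>p\<close> is forced, and the
  \<open>l\<close>-subsets of the progression of odd numbers in \<open>(j, p)\<close> contribute a \<open>q\<close>-binomial coefficient.
  Even columns \<open>j = 2m\<close> require \<open>t - l\<close> odd, odd columns \<open>j = 2m + 1\<close> require \<open>t - l\<close> even; these are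
  the two sums of the theorem, with \<open>l = 2k\<close> or \<open>l = 2k + 1\<close> according to the parity of \<open>t\<close>.\<close>

unbundle fps_syntax

section \<open>Generating functions of families of finite sets, graded by element sum\<close>

definition subset_sum_fps :: "nat set set \<Rightarrow> 'a::semiring_1 fps" where
  "subset_sum_fps F = Abs_fps (\<lambda>n. of_nat (card {S \<in> F. \<Sum>S = n}))"

text \<open>An element of a finite set of naturals is at most the sum of the set, so only subsets of
  \<open>{..n}\<close> occur. \<open>Fpow\<close> keeps out infinite sets, whose sum is 0 by
  default.\<close>

lemma finite_Fpow_sum_eq:
  fixes A :: "nat set"
  assumes "F \<subseteq> Fpow A"
  shows "finite {S \<in> F. \<Sum>S = n}"
proof (rule finite_subset)
  show "{S \<in> F. \<Sum>S = n} \<subseteq> Pow {..n}"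
    using assms by (auto simp: Fpow_def intro: member_le_sum[of _ _ "\<lambda>x. x", simplified])
qed simp

text \<open>As \<open>A\<close> and \<open>B\<close> are disjoint, a union \<open>U\<close>
  determines its two pieces as \<open>U \<inter> A\<close> and \<open>U \<inter> B\<close>, and
  element sums add. Counting unions by sum is therefore a Cauchy convolution.\<close>

lemma subset_sum_fps_mult:
  assumes "A \<inter> B = {}" "F \<subseteq> Fpow A" "G \<subseteq> Fpow B"
  shows "subset_sum_fps ((\<lambda>(S, T). S \<union> T) ` (F \<times> G)) =
           (subset_sum_fps F * subset_sum_fps G :: 'a::semiring_1 fps)"
proof (rule fps_ext)
  fix n
  let ?u = "\<lambda>(S, T). S \<union> T"
  let ?F = "\<lambda>i. {S \<in> F. \<Sum>S = i}" and ?G = "\<lambda>i. {S \<in> G. \<Sum>S = i}"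
  have fin: "finite (?F i)" "finite (?G i)" for i
    using assms finite_Fpow_sum_eq by blast+
  have parts: "(S \<union> T) \<inter> A = S \<and> (S \<union> T) \<inter> B = T" if "S \<in> F" "T \<in> G" for S T
    using that assms by (fastforce simp: Fpow_def)
  have inj: "inj_on ?u (F \<times> G)"
    by (rule inj_on_inverseI[where g = "\<lambda>U. (U \<inter> A, U \<inter> B)"]) (auto dest: parts simp: parts)
  have sum_Un: "\<Sum>(S \<union> T) = \<Sum>S + \<Sum>T" if "S \<in> F" "T \<in> G" for S T
    using that assms by (intro sum.union_disjoint) (auto simp: Fpow_def)
  have "{U \<in> ?u ` (F \<times> G). \<Sum>U = n} = ?u ` (\<Union>i\<in>{0..n}. ?F i \<times> ?G (n - i))"
    using sum_Un by (auto simp: image_iff)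
  also have "card \<dots> = card (\<Union>i\<in>{0..n}. ?F i \<times> ?G (n - i))"
    by (rule card_image, rule inj_on_subset[OF inj]) auto
  also have "\<dots> = (\<Sum>i=0..n. card (?F i \<times> ?G (n - i)))"
    by (rule card_UN_disjoint) (use fin in auto)
  finally show "subset_sum_fps (?u ` (F \<times> G)) $ n =
      (subset_sum_fps F * subset_sum_fps G :: 'a fps) $ n"
    by (simp add: subset_sum_fps_def fps_mult_nth card_cartesian_product)
qed

lemma subset_sum_fps_finite:
  assumes "finite F"
  shows "(subset_sum_fps F :: 'a::comm_semiring_1 fps) = (\<Sum>S\<in>F. fps_X ^ \<Sum>S)"
proof (rule fps_ext)
  fix n
  have "(\<Sum>S\<in>F. fps_X ^ \<Sum>S :: 'a fps) $ n = (\<Sum>S\<in>F. if \<Sum>S = n then 1 else 0)"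
    by (auto simp: fps_sum_nth intro!: sum.cong)
  also have "\<dots> = of_nat (card {S \<in> F. \<Sum>S = n})"
    using assms by (simp flip: sum.inter_filter)
  finally show "subset_sum_fps F $ n = (\<Sum>S\<in>F. fps_X ^ \<Sum>S :: 'a fps) $ n"
    by (simp add: subset_sum_fps_def)
qed

lemma subset_sum_fps_Pow:
  assumes "finite A"
  shows "(subset_sum_fps (Pow A) :: 'a::comm_semiring_1 fps) = (\<Prod>a\<in>A. 1 + fps_X ^ a)"
proof -
  have "(\<Prod>a\<in>A. fps_X ^ a + 1 :: 'a fps) = (\<Sum>S\<in>Pow A. (\<Prod>a\<in>S. fps_X ^ a) * (\<Prod>a\<in>A - S. 1))"
    by (rule prod_add[OF assms])
  then show ?thesis
    using assms by (simp add: subset_sum_fps_finite power_sum add.commute)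
qed

section \<open>q-Pochhammer symbols and q-binomial coefficients\<close>

lemma q_poch_Suc: "q_poch x q (Suc n) = q_poch x q n * (1 - x * q ^ n)"
  by (simp add: q_poch_def)

lemma q_poch_nth_0:
  fixes x q :: "'a::comm_ring_1 fps"
  assumes "x $ 0 = 0"
  shows "q_poch x q n $ 0 = 1"
  using assms by (induction n) (auto simp: q_poch_Suc, simp add: q_poch_def)

lemma q_poch_neq_0:
  fixes x q :: "'a::comm_ring_1 fps"
  assumes "x $ 0 = 0"
  shows "q_poch x q n \<noteq> 0"
  using q_poch_nth_0[OF assms, of q n] by auto

text \<open>Every \<open>q_poch q q n\<close> has constant term 1, so the division defining
  \<open>q_binom\<close> is by a unit and the denominator can be cleared.\<close>

lemma q_binom_mult:
  fixes q :: "'a::field fps"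
  assumes "q $ 0 = 0" "k \<le> n"
  shows "q_binom n k q * (q_poch q q k * q_poch q q (n - k)) = q_poch q q n"
proof -
  have "(q_poch q q k * q_poch q q (n - k)) $ 0 \<noteq> 0"
    using assms by (simp add: q_poch_nth_0)
  then show ?thesis
    using assms by (simp add: q_binom_def fps_divide_unit inverse_mult_eq_1 mult.assoc)
qed

lemma q_binom_0_right:
  fixes q :: "'a::field fps"
  assumes "q $ 0 = 0"
  shows "q_binom n 0 q = 1"
  using q_binom_mult[OF assms, of 0 n] q_poch_neq_0[OF assms, of q n] by (simp add: q_poch_def)

lemma q_binom_eq_0: "n < k \<Longrightarrow> q_binom n k q = 0"
  by (simp add: q_binom_def)

text \<open>This is the q-Pascal rule, in the version that fits splitting off the largest element of
  a progression. Both sides are multiplied by the nonzero common denominator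
  \<open>?P (Suc k) * ?P (n - k)\<close>, which is then cancelled.\<close>

lemma q_binom_Suc_Suc:
  fixes q :: "'a::field fps"
  assumes "q $ 0 = 0" "k \<le> n"
  shows "q_binom (Suc n) (Suc k) q = q_binom n (Suc k) q + q ^ (n - k) * q_binom n k q"
proof -
  let ?P = "q_poch q q" and ?B = "\<lambda>n k. q_binom n k q"
  have A: "?B (Suc n) (Suc k) * (?P (Suc k) * ?P (n - k)) = ?P (Suc n)"
    using q_binom_mult[of q "Suc k" "Suc n"] assms by simp
  have C: "?B n k * (?P k * ?P (n - k)) = ?P n"
    using q_binom_mult[of q k n] assms by simp
  \<comment> \<open>For \<open>k = n\<close> both sides vanish: the binomial by convention, the
    right side through \<open>1 - q ^ 0\<close>.\<close>
  have B: "?B n (Suc k) * (?P (Suc k) * ?P (n - k)) = ?P n * (1 - q ^ (n - k))"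
  proof (cases "k = n")
    case False
    then obtain r where r: "n - k = Suc r" "n - Suc k = r" "Suc k \<le> n"
      using assms(2) by (metis Suc_diff_Suc Suc_leI le_neq_implies_less)
    have "?B n (Suc k) * (?P (Suc k) * ?P r) * (1 - q * q ^ r) = ?P n * (1 - q ^ (n - k))"
      using q_binom_mult[of q "Suc k" n] assms r by simp
    then show ?thesis
      unfolding r(1) q_poch_Suc[of q q r] by (simp only: mult_ac)
  qed (simp add: q_binom_eq_0)
  have "(?B n (Suc k) + q ^ (n - k) * ?B n k) * (?P (Suc k) * ?P (n - k)) =
      ?P n * (1 - q ^ (n - k)) + q ^ (n - k) * (1 - q * q ^ k) * (?B n k * (?P k * ?P (n - k)))"
    unfolding distrib_right B by (simp add: q_poch_Suc[of q q k] mult_ac)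
  also have "\<dots> = ?P n * (1 - q * (q ^ (n - k) * q ^ k))"
    unfolding C by (simp add: algebra_simps)
  also have "\<dots> = ?P (Suc n)"
    using assms(2) by (simp add: q_poch_Suc flip: power_add)
  finally have "(?B n (Suc k) + q ^ (n - k) * ?B n k) * (?P (Suc k) * ?P (n - k)) =
      ?B (Suc n) (Suc k) * (?P (Suc k) * ?P (n - k))"
    using A by simp
  then show ?thesis
    using q_poch_neq_0[OF assms(1)] by simp
qed

text \<open>The exponent \<open>l * c + l * (l - 1)\<close> is the sum of the \<open>l\<close>
  smallest terms of the progression. The induction on \<open>N\<close> splits the subsets by whether
  they contain the last term \<open>c + 2 * N\<close>, which is the q-Pascal rule with base
  \<open>fps_X ^ 2\<close>.\<close>

lemma subset_sum_fps_card_subsets: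
  fixes c N l :: nat
  shows "(subset_sum_fps {T. T \<subseteq> (\<lambda>i. c + 2 * i) ` {..<N} \<and> card T = l} :: 'a::field fps) =
           fps_X ^ (l * c + l * (l - 1)) * q_binom N l (fps_X ^ 2)"
proof -
  let ?X = "fps_X :: 'a fps"
  define A where "A N = (\<lambda>i. c + 2 * i) ` {..<N}" for N
  define F where "F N l = {T. T \<subseteq> A N \<and> card T = l}" for N l
  have finA: "finite (A N)" for N
    by (simp add: A_def)
  have finF: "finite (F N l)" for N l
    unfolding F_def using finA by simp
  have X0: "(?X ^ 2) $ 0 = 0"
    by simp
  have fin_mem: "finite T" if "T \<in> F N l" for T N l
    using that finA finite_subset unfolding F_def by blast
  have "(\<Sum>T\<in>F N l. ?X ^ \<Sum>T) = ?X ^ (l * c + l * (l - 1)) * q_binom N l (?X ^ 2)"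
  proof (induction N arbitrary: l)
    case 0
    have "F 0 l = (if l = 0 then {{}} else {})"
      by (auto simp: F_def A_def)
    then show ?case
      by (simp add: q_binom_0_right[OF X0] q_binom_eq_0)
  next
    case (Suc N)
    show ?case
    proof (cases l)
      case 0
      have "F (Suc N) 0 = {{}}"
        using finA[of "Suc N"] by (auto simp: F_def dest: finite_subset)
      then show ?thesis
        by (simp add: 0 q_binom_0_right[OF X0])
    next
      case (Suc k)
      define x where "x = c + 2 * N"
      have A_Suc: "A (Suc N) = insert x (A N)"
        by (auto simp: A_def x_def lessThan_Suc)
      have x_notin: "x \<notin> A N"
        by (auto simp: A_def x_def)
      have x_notin_mem: "x \<notin> T" if "T \<in> F N k" for T
        using that x_notin unfolding F_def by blast
      have F_Suc: "F (Suc N) (Suc k) = F N (Suc k) \<union> insert x ` F N k"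
      proof (intro equalityI subsetI)
        fix T assume T: "T \<in> F (Suc N) (Suc k)"
        show "T \<in> F N (Suc k) \<union> insert x ` F N k"
        proof (cases "x \<in> T")
          case True
          then have "T - {x} \<in> F N k" "T = insert x (T - {x})"
            using T unfolding F_def A_Suc by auto
          then show ?thesis by blast
        qed (use T in \<open>auto simp: F_def A_Suc\<close>)
      next
        fix T assume "T \<in> F N (Suc k) \<union> insert x ` F N k"
        then consider "T \<in> F N (Suc k)" | U where "T = insert x U" "U \<in> F N k"
          by blast
        then show "T \<in> F (Suc N) (Suc k)"
        proof cases
          case 2
          then have "card T = Suc k"
            using x_notin_mem[of U] fin_mem[of U N k] by (simp add: F_def)
          then show ?thesis
            using 2 by (auto simp: F_def A_Suc)
        qed (auto simp: F_def A_Suc)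
      qed
      have inj: "inj_on (insert x) (F N k)"
        using x_notin_mem by (intro inj_onI) (metis insert_ident)
      have "(\<Sum>T\<in>F (Suc N) (Suc k). ?X ^ \<Sum>T) =
          (\<Sum>T\<in>F N (Suc k). ?X ^ \<Sum>T) + (\<Sum>T\<in>insert x ` F N k. ?X ^ \<Sum>T)"
        unfolding F_Suc using finF x_notin
        by (intro sum.union_disjoint) (auto simp: F_def)
      also have "(\<Sum>T\<in>insert x ` F N k. ?X ^ \<Sum>T) = (\<Sum>T\<in>F N k. ?X ^ x * ?X ^ \<Sum>T)"
        using x_notin_mem fin_mem by (simp add: sum.reindex[OF inj] power_add)
      also have "\<dots> = ?X ^ x * (?X ^ (k * c + k * (k - 1)) * q_binom N k (?X ^ 2))"
        by (simp add: Suc.IH flip: sum_distrib_left)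
      also have "\<dots> = ?X ^ (x + (k * c + k * (k - 1))) * q_binom N k (?X ^ 2)"
        by (simp add: power_add mult.assoc)
      finally have sum_eq: "(\<Sum>T\<in>F (Suc N) (Suc k). ?X ^ \<Sum>T) =
          ?X ^ (Suc k * c + Suc k * k) * q_binom N (Suc k) (?X ^ 2) +
          ?X ^ (x + (k * c + k * (k - 1))) * q_binom N k (?X ^ 2)"
        by (simp add: Suc.IH)
      show ?thesis
      proof (cases "k \<le> N")
        case True
        then obtain d where d: "N = k + d"
          using le_Suc_ex by blast
        \<comment> \<open>Adjoining \<open>x\<close> to the \<open>k\<close> smallest terms exceeds
          the minimal sum of \<open>k + 1\<close> terms by \<open>2 * (N - k)\<close>; this excess
          is the power of the base in the q-Pascal rule.\<close>
        have "x + (k * c + k * (k - 1)) = Suc k * c + Suc k * k + 2 * (N - k)"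
          by (cases k) (simp_all add: x_def d algebra_simps)
        then have "?X ^ (x + (k * c + k * (k - 1))) =
            ?X ^ (Suc k * c + Suc k * k) * (?X ^ 2) ^ (N - k)"
          by (simp only: power_add power_mult)
        then show ?thesis
          unfolding Suc sum_eq q_binom_Suc_Suc[OF X0 True] by (simp add: distrib_left mult.assoc)
      next
        case False
        then show ?thesis
          unfolding Suc sum_eq by (simp add: q_binom_eq_0)
      qed
    qed
  qed
  then show ?thesis
    using finF by (simp add: subset_sum_fps_finite flip: A_def F_def)
qed

section \<open>Partitions into distinct odd parts as sets, and their hooks\<close>

lemma bij_betw_set_DO: "bij_betw set (DO n) {S \<in> Fpow {p. odd p}. \<Sum>S = n}"
  unfolding bij_betw_def
proof
  show "inj_on set (DO n)"
  proof (rule inj_onI)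
    fix xs ys assume "xs \<in> DO n" "ys \<in> DO n" "set xs = set ys"
    then have "rev xs = rev ys"
      by (intro sorted_distinct_set_unique) (auto simp: DO_def is_partition_def sorted_wrt_rev)
    then show "xs = ys" by simp
  qed
  show "set ` DO n = {S \<in> Fpow {p. odd p}. \<Sum>S = n}"
  proof (intro equalityI subsetI)
    fix S assume "S \<in> set ` DO n"
    then show "S \<in> {S \<in> Fpow {p. odd p}. \<Sum>S = n}"
      by (auto simp: DO_def is_partition_def Fpow_def sum_list_distinct_conv_sum_set[where f = "\<lambda>x. x", simplified])
  next
    fix S assume S: "S \<in> {S \<in> Fpow {p. odd p}. \<Sum>S = n}"
    then have "rev (sorted_list_of_set S) \<in> DO n"
      by (auto simp: DO_def is_partition_def Fpow_def sorted_wrt_rev odd_pos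
            sum_list_distinct_conv_sum_set[where f = "\<lambda>x. x", simplified])
    moreover have "S = set (rev (sorted_list_of_set S))"
      using S by (simp add: Fpow_def)
    ultimately show "S \<in> set ` DO n" by blast
  qed
qed

text \<open>Distinct parts allow row \<open>i\<close> to be named by its part
  \<open>p = lam ! i\<close>. The arm of box \<open>(i, j)\<close> has \<open>p - j - 1\<close>
  boxes, so arm plus one is \<open>p - j\<close>; the leg counts the parts strictly between
  \<open>j\<close> and \<open>p\<close>.\<close>

lemma hook_count_distinct:
  assumes "is_partition lam n" "distinct lam"
  shows "hook_count t lam =
    card {(p, j). p \<in> set lam \<and> j < p \<and> p - j + card (set lam \<inter> {j<..<p}) = t}"
proof -
  have desc: "lam ! i' < lam ! i \<longleftrightarrow> i < i'" if "i < length lam" "i' < length lam" for i i'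
    using assms that unfolding is_partition_def sorted_wrt_iff_nth_less
    by (metis linorder_neqE_nat nth_eq_iff_index_eq order_le_less order_less_asym)
  have hook: "hook_number lam (i, j) = lam ! i - j + card (set lam \<inter> {j<..<lam ! i})"
    if b: "i < length lam" "j < lam ! i" for i j
  proof -
    have "{j'. j < j' \<and> (i, j') \<in> boxes lam} = {j<..<lam ! i}"
      using b by (auto simp: boxes_def)
    \<comment> \<open>Parts strictly decrease down the rows, so the rows below \<open>i\<close> are
      exactly those with a smaller part; such a row meets column \<open>j\<close> when its part
      exceeds \<open>j\<close>.\<close>
    moreover have "set lam \<inter> {j<..<lam ! i} = (!) lam ` {i'. i < i' \<and> (i', j) \<in> boxes lam}"
      using b desc by (auto simp: boxes_def in_set_conv_nth)
    moreover have "inj_on ((!) lam) {i'. i < i' \<and> (i', j) \<in> boxes lam}"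
      using assms by (intro inj_on_nth) (auto simp: boxes_def)
    ultimately show ?thesis
      using b by (simp add: hook_number_def card_image)
  qed
  have "bij_betw (\<lambda>(i, j). (lam ! i, j)) {b \<in> boxes lam. hook_number lam b = t}
      {(p, j). p \<in> set lam \<and> j < p \<and> p - j + card (set lam \<inter> {j<..<p}) = t}"
    unfolding bij_betw_def
  proof
    show "inj_on (\<lambda>(i, j). (lam ! i, j)) {b \<in> boxes lam. hook_number lam b = t}"
      using assms by (auto simp: inj_on_def boxes_def nth_eq_iff_index_eq)
    show "(\<lambda>(i, j). (lam ! i, j)) ` {b \<in> boxes lam. hook_number lam b = t} =
        {(p, j). p \<in> set lam \<and> j < p \<and> p - j + card (set lam \<inter> {j<..<p}) = t}"
      by (auto simp: boxes_def hook image_iff in_set_conv_nth)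
  qed
  then show ?thesis
    unfolding hook_count_def by (rule bij_betw_same_card)
qed

text \<open>Here \<open>l\<close> is the leg length and \<open>j + (t - l)\<close> the part whose
  row holds the box. A hook number \<open>t\<close> forces \<open>l < t\<close>.\<close>

definition hook_sets :: "nat \<Rightarrow> nat \<Rightarrow> nat \<Rightarrow> nat set set" where
  "hook_sets t j l = {S \<in> Fpow {p. odd p}. j + (t - l) \<in> S \<and> card (S \<inter> {j<..<j + (t - l)}) = l}"

text \<open>Double counting: the sum over partitions is exchanged with the sum over pairs of leg and
  column. A column satisfies \<open>j < p \<le> n\<close>, so any bound \<open>M \<ge> n\<close> on
  the columns serves; leaving \<open>M\<close> free allows an even bound later.\<close>

lemma b_star_eq_sum_hook_sets:
  assumes "n \<le> M"
  shows "b_star t n = (\<Sum>l<t. \<Sum>j<M. card {S \<in> hook_sets t j l. \<Sum>S = n})"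
proof -
  let ?O = "{S \<in> Fpow {p. odd p}. \<Sum>S = n}"
  let ?R = "\<lambda>S (l, j). j + (t - l) \<in> S \<and> card (S \<inter> {j<..<j + (t - l)}) = l"
  have fin: "finite ?O"
    by (rule finite_Fpow_sum_eq[OF subset_refl])
  have "b_star t n = (\<Sum>lam\<in>DO n. card {x \<in> {..<t} \<times> {..<M}. ?R (set lam) x})"
    unfolding b_star_def
  proof (rule sum.cong)
    fix lam assume lam: "lam \<in> DO n"
    have le: "p < Suc M" if "p \<in> set lam" for p
      using lam assms that member_le_sum_list[of p lam] by (auto simp: DO_def is_partition_def)
    let ?S = "set lam"
    have "bij_betw (\<lambda>(l, j). (j + (t - l), j)) {x \<in> {..<t} \<times> {..<M}. ?R ?S x}
        {(p, j). p \<in> ?S \<and> j < p \<and> p - j + card (?S \<inter> {j<..<p}) = t}"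
    proof (rule bij_betwI[where g = "\<lambda>(p, j). (t - (p - j), j)"])
      show "(\<lambda>(p, j). (t - (p - j), j)) \<in> {(p, j). p \<in> ?S \<and> j < p \<and> p - j + card (?S \<inter> {j<..<p}) = t}
          \<rightarrow> {x \<in> {..<t} \<times> {..<M}. ?R ?S x}"
        using le by fastforce
    qed auto
    from bij_betw_same_card[OF this]
    show "hook_count t lam = card {x \<in> {..<t} \<times> {..<M}. ?R ?S x}"
      using lam by (simp add: DO_def hook_count_distinct[of lam n])
  qed simp
  also have "\<dots> = (\<Sum>S\<in>?O. card {x \<in> {..<t} \<times> {..<M}. ?R S x})"
    by (rule sum.reindex_bij_betw[OF bij_betw_set_DO])
  also have "\<dots> = (\<Sum>x\<in>{..<t} \<times> {..<M}. card {S \<in> ?O. ?R S x})"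
    unfolding card_eq_sum using fin by (intro sum.swap_restrict) auto
  also have "\<dots> = (\<Sum>l<t. \<Sum>j<M. card {S \<in> hook_sets t j l. \<Sum>S = n})"
    unfolding sum.cartesian_product
    by (intro sum.cong) (auto simp: hook_sets_def intro!: arg_cong[where f = card])
  finally show ?thesis .
qed

section \<open>The generating function for a fixed column and leg length\<close>

lemma q_poch_eq_subset_sum_fps:
  assumes "c > 0"
  shows "(q_poch (- (fps_X ^ c)) (fps_X ^ 2) N :: 'a::comm_ring_1 fps) =
           subset_sum_fps (Pow ((\<lambda>i. c + 2 * i) ` {..<N}))"
proof -
  have "inj_on (\<lambda>i. c + 2 * i) {..<N}"
    by (simp add: inj_on_def)
  then show ?thesis
    by (simp add: subset_sum_fps_Pow prod.reindex q_poch_def power_add power_mult)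
qed

text \<open>Coefficient \<open>k\<close> of the partial products is constant once
  \<open>n \<ge> k\<close>: a set with sum \<open>k\<close> has elements at most \<open>k\<close>,
  and the odd ones among these are \<open>1 + 2 * i\<close> with \<open>i < n\<close>.\<close>

lemma q_poch_inf_eq_subset_sum_fps:
  "(q_poch_inf (- fps_X) (fps_X ^ 2) :: 'a::comm_ring_1 fps) = subset_sum_fps (Fpow {p. odd p})"
  unfolding q_poch_inf_def
proof (rule limI, rule tendsto_fpsI)
  fix k
  show "eventually (\<lambda>n. q_poch (- fps_X) (fps_X ^ 2) n $ k =
      (subset_sum_fps (Fpow {p. odd p}) :: 'a fps) $ k) sequentially"
    using eventually_ge_at_top[of k]
  proof eventually_elim
    case (elim n)
    let ?A = "(\<lambda>i. 1 + 2 * i) ` {..<n}"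
    have "{S \<in> Pow ?A. \<Sum>S = k} = {S \<in> Fpow {p. odd p}. \<Sum>S = k}"
    proof (intro equalityI subsetI)
      fix S assume "S \<in> {S \<in> Pow ?A. \<Sum>S = k}"
      then show "S \<in> {S \<in> Fpow {p. odd p}. \<Sum>S = k}"
        using finite_subset[of S ?A] by (auto simp: Fpow_def)
    next
      fix S assume S: "S \<in> {S \<in> Fpow {p. odd p}. \<Sum>S = k}"
      have "p \<in> ?A" if "p \<in> S" for p
      proof -
        have "p \<le> k" "odd p"
          using S that by (auto simp: Fpow_def intro: member_le_sum[of _ _ "\<lambda>x. x", simplified])
        then show ?thesis
          using elim by (auto elim!: oddE)
      qed
      then show "S \<in> {S \<in> Pow ?A. \<Sum>S = k}"
        using S by blast
    qed
    then show ?case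
      using q_poch_eq_subset_sum_fps[of 1 n, where 'a = 'a] by (simp add: subset_sum_fps_def)
  qed
qed

text \<open>The hypotheses make \<open>c\<close> the least odd number above \<open>j\<close>, so
  \<open>c, c + 2, ..., c + 2 * N\<close> are the odd numbers in \<open>(j, p]\<close>. Both the
  full product and the series of \<open>hook_sets t j l\<close> contain the factor
  \<open>subset_sum_fps (Fpow C)\<close> of the unconstrained odd numbers; cross-multiplying by the
  finite product compares them without division.\<close>

lemma subset_sum_fps_hook_sets_mult:
  fixes t j l c N :: nat
  assumes "l < t" "odd c" "c = j + 1 \<or> c = j + 2" "j + (t - l) = c + 2 * N"
  shows "(subset_sum_fps (hook_sets t j l) :: 'a::field fps) *
             q_poch (- (fps_X ^ c)) (fps_X ^ 2) (Suc N) =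
           q_poch_inf (- fps_X) (fps_X ^ 2) *
             (fps_X ^ (c + 2 * N + (l * c + l * (l - 1))) * q_binom N l (fps_X ^ 2))"
proof -
  let ?u = "\<lambda>(S, T). S \<union> T :: nat set"
  define p where "p = c + 2 * N"
  define A where "A = (\<lambda>i. c + 2 * i) ` {..<N}"
  define C where "C = {p. odd p} - insert p A"
  define F where "F = {T. T \<subseteq> A \<and> card T = l}"
  have disj: "C \<inter> insert p A = {}"
    by (auto simp: C_def)
  have finA: "finite A"
    by (simp add: A_def)
  have p_notin: "p \<notin> A"
    by (auto simp: p_def A_def)
  have odd_A: "insert p A \<subseteq> {p. odd p}"
    using assms(2) by (auto simp: p_def A_def)
  have A_eq: "x \<in> A \<longleftrightarrow> odd x \<and> j < x \<and> x < p" for x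
  proof
    assume x: "odd x \<and> j < x \<and> x < p"
    have "c \<le> x"
      using x assms(2,3) by (cases "x = j + 1") auto
    then obtain r where r: "x = c + r"
      using le_Suc_ex by blast
    then have "even r"
      using x assms(2) by simp
    then show "x \<in> A"
      using x r by (auto simp: A_def p_def elim!: evenE)
  qed (use assms in \<open>auto simp: A_def p_def\<close>)
  have insert_A: "(\<lambda>i. c + 2 * i) ` {..<Suc N} = insert p A"
    by (auto simp: A_def p_def lessThan_Suc)
  have "Fpow {p. odd p} = ?u ` (Fpow C \<times> Pow (insert p A))"
  proof (intro equalityI subsetI)
    fix S :: "nat set" assume "S \<in> Fpow {p. odd p}"
    then have "S - insert p A \<in> Fpow C" "S \<inter> insert p A \<in> Pow (insert p A)"
      by (auto simp: Fpow_def C_def)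
    moreover have "S = ?u (S - insert p A, S \<inter> insert p A)"
      by auto
    ultimately show "S \<in> ?u ` (Fpow C \<times> Pow (insert p A))"
      by blast
  next
    fix S assume "S \<in> ?u ` (Fpow C \<times> Pow (insert p A))"
    then show "S \<in> Fpow {p. odd p}"
      using odd_A finA by (auto simp: Fpow_def C_def intro: finite_subset[of _ "insert p A"])
  qed
  moreover have "Pow (insert p A) \<subseteq> Fpow (insert p A)"
    using finA by (auto simp: Fpow_def intro: finite_subset[of _ "insert p A"])
  ultimately have P: "(subset_sum_fps (Fpow {p. odd p}) :: 'a fps) =
      subset_sum_fps (Fpow C) * subset_sum_fps (Pow (insert p A))"
    by (simp add: subset_sum_fps_mult[OF disj])
  \<comment> \<open>A member of \<open>hook_sets t j l\<close> splits uniquely into a free part in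
    \<open>C\<close>, the forced element \<open>p\<close>, and an \<open>l\<close>-subset of
    \<open>A\<close>.\<close>
  have hook: "hook_sets t j l = ?u ` (Fpow C \<times> ?u ` ({{p}} \<times> F))"
  proof (intro equalityI subsetI)
    fix S assume S: "S \<in> hook_sets t j l"
    have pS: "p \<in> S" and oddS: "S \<subseteq> {p. odd p}" "finite S"
      using S assms(4) by (auto simp: hook_sets_def p_def Fpow_def)
    have "S \<inter> A = S \<inter> {j<..<p}"
      using oddS A_eq by auto
    then have "card (S \<inter> A) = l"
      using S assms(4) by (simp add: hook_sets_def p_def)
    then have "S \<inter> A \<in> F"
      by (simp add: F_def)
    then have "?u ({p}, S \<inter> A) \<in> ?u ` ({{p}} \<times> F)"
      by blast
    moreover have "S - insert p A \<in> Fpow C"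
      using oddS by (auto simp: Fpow_def C_def)
    ultimately have "(S - insert p A, ?u ({p}, S \<inter> A)) \<in> Fpow C \<times> ?u ` ({{p}} \<times> F)"
      by (intro SigmaI)
    then show "S \<in> ?u ` (Fpow C \<times> ?u ` ({{p}} \<times> F))"
      by (rule rev_image_eqI) (use pS in auto)
  next
    fix S assume "S \<in> ?u ` (Fpow C \<times> ?u ` ({{p}} \<times> F))"
    then obtain D T where S: "S = D \<union> ({p} \<union> T)" and D: "D \<in> Fpow C" and T: "T \<in> F"
      by auto
    have T': "finite T" "T \<subseteq> A" "card T = l"
      using T finA by (auto simp: F_def intro: finite_subset)
    have D': "D \<subseteq> {p. odd p}" "D \<inter> A = {}" "finite D"
      using D by (auto simp: Fpow_def C_def)
    have "S \<inter> {j<..<p} = T"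
    proof (rule set_eqI)
      fix x
      show "x \<in> S \<inter> {j<..<p} \<longleftrightarrow> x \<in> T"
        using A_eq[of x] D'(1,2) T'(2) unfolding S by auto
    qed
    then show "S \<in> hook_sets t j l"
      using odd_A assms(4) D' T' unfolding S by (auto simp: hook_sets_def Fpow_def p_def)
  qed
  have F: "F \<subseteq> Fpow A"
    using finA by (auto simp: F_def Fpow_def intro: finite_subset)
  have pF: "?u ` ({{p}} \<times> F) \<subseteq> Fpow (insert p A)"
    using F by (auto simp: Fpow_def)
  have "(subset_sum_fps (?u ` ({{p}} \<times> F)) :: 'a fps) = subset_sum_fps {{p}} * subset_sum_fps F"
    by (rule subset_sum_fps_mult[of "{p}" A]) (use F p_notin in \<open>auto simp: Fpow_def\<close>)
  also have "\<dots> = fps_X ^ (p + (l * c + l * (l - 1))) * q_binom N l (fps_X ^ 2)"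
    unfolding F_def A_def subset_sum_fps_card_subsets
    by (simp add: subset_sum_fps_finite power_add mult.assoc)
  finally have "(subset_sum_fps (hook_sets t j l) :: 'a fps) = subset_sum_fps (Fpow C) *
      (fps_X ^ (p + (l * c + l * (l - 1))) * q_binom N l (fps_X ^ 2))"
    unfolding hook using pF by (simp add: subset_sum_fps_mult[OF disj])
  moreover have "(q_poch (- (fps_X ^ c)) (fps_X ^ 2) (Suc N) :: 'a fps) =
      subset_sum_fps (Pow (insert p A))"
    using assms(2) q_poch_eq_subset_sum_fps[of c "Suc N"] by (simp add: insert_A odd_pos)
  ultimately show ?thesis
    unfolding q_poch_inf_eq_subset_sum_fps P by (simp add: p_def mult_ac)
qed

lemma hook_sets_empty: "even (j + (t - l)) \<Longrightarrow> hook_sets t j l = {}"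
  by (auto simp: hook_sets_def Fpow_def)

lemma q_poch_X_nth_0_neq:
  "c > 0 \<Longrightarrow> (q_poch (- (fps_X ^ c)) q N :: 'a::comm_ring_1 fps) $ 0 \<noteq> 0"
  by (simp add: q_poch_nth_0)

text \<open>Column \<open>2 * m\<close> has \<open>c = 2 * m + 1\<close> and
  \<open>t - l = 2 * N + 1\<close>. Relative to column 0, the part \<open>p\<close> and the
  \<open>l\<close> elements below it each move up by \<open>2 * m\<close>, which accounts for the
  factor \<open>fps_X ^ (2 * m * (l + 1))\<close>; the rest of the numerator is independent of
  \<open>m\<close>.\<close>

lemma subset_sum_fps_hook_sets_even_column:
  fixes t l m :: nat
  assumes "l < t" "odd (t - l)"
  shows "(subset_sum_fps (hook_sets t (2 * m) l) :: 'a::field fps) =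
    q_poch_inf (- fps_X) (fps_X ^ 2) *
      (fps_X ^ (t + l * (l - 1)) * q_binom ((t - l - 1) div 2) l (fps_X ^ 2)) *
      (fps_X ^ (2 * m * (l + 1)) /
         q_poch (- (fps_X ^ (2 * m + 1))) (fps_X ^ 2) ((t - l + 1) div 2))"
proof -
  obtain N where N: "t - l = 2 * N + 1"
    using assms(2) by (elim oddE)
  then have t: "t = l + (2 * N + 1)"
    using assms(1) by linarith
  let ?Q = "q_poch (- (fps_X ^ (2 * m + 1))) (fps_X ^ 2) (Suc N) :: 'a fps"
  have Q: "?Q $ 0 \<noteq> 0"
    by (rule q_poch_X_nth_0_neq) simp
  have e: "2 * m + 1 + 2 * N + (l * (2 * m + 1) + l * (l - 1)) =
      (t + l * (l - 1)) + 2 * m * (l + 1)"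
    unfolding t by (cases l) (simp_all add: algebra_simps)
  have "subset_sum_fps (hook_sets t (2 * m) l) * ?Q =
      q_poch_inf (- fps_X) (fps_X ^ 2) *
        (fps_X ^ ((t + l * (l - 1)) + 2 * m * (l + 1)) * q_binom N l (fps_X ^ 2))"
    unfolding e[symmetric] by (rule subset_sum_fps_hook_sets_mult) (use assms N in auto)
  moreover have "(t - l - 1) div 2 = N" "(t - l + 1) div 2 = Suc N"
    using N by auto
  moreover have "(subset_sum_fps (hook_sets t (2 * m) l) :: 'a fps) =
      subset_sum_fps (hook_sets t (2 * m) l) * ?Q * inverse ?Q"
    by (simp only: mult.assoc inverse_mult_eq_1'[OF Q] mult_1_right)
  ultimately show ?thesis
    using Q by (simp add: fps_divide_unit power_add mult_ac)
qed

text \<open>As for even columns, now with \<open>c = 2 * m + 3\<close> and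
  \<open>t - l = 2 * N + 2\<close>. Starting two above \<open>j\<close> instead of one turns
  \<open>l * (l - 1)\<close> into \<open>l * (l + 1) + 1\<close>.\<close>

lemma subset_sum_fps_hook_sets_odd_column:
  fixes t l m :: nat
  assumes "l < t" "even (t - l)"
  shows "(subset_sum_fps (hook_sets t (2 * m + 1) l) :: 'a::field fps) =
    q_poch_inf (- fps_X) (fps_X ^ 2) *
      (fps_X ^ (t + l * (l + 1) + 1) * q_binom ((t - l - 2) div 2) l (fps_X ^ 2)) *
      (fps_X ^ (2 * m * (l + 1)) /
         q_poch (- (fps_X ^ (2 * m + 3))) (fps_X ^ 2) ((t - l) div 2))"
proof -
  obtain N' where N': "t - l = 2 * N'"
    using assms(2) by (elim evenE)
  then obtain N where N: "t - l = 2 * N + 2"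
    using assms(1) by (cases N') auto
  then have t: "t = l + (2 * N + 2)"
    using assms(1) by linarith
  let ?Q = "q_poch (- (fps_X ^ (2 * m + 3))) (fps_X ^ 2) (Suc N) :: 'a fps"
  have Q: "?Q $ 0 \<noteq> 0"
    by (rule q_poch_X_nth_0_neq) simp
  have e: "2 * m + 3 + 2 * N + (l * (2 * m + 3) + l * (l - 1)) =
      (t + l * (l + 1) + 1) + 2 * m * (l + 1)"
    unfolding t by (cases l) (simp_all add: algebra_simps)
  have "subset_sum_fps (hook_sets t (2 * m + 1) l) * ?Q =
      q_poch_inf (- fps_X) (fps_X ^ 2) *
        (fps_X ^ ((t + l * (l + 1) + 1) + 2 * m * (l + 1)) * q_binom N l (fps_X ^ 2))"
    unfolding e[symmetric] by (rule subset_sum_fps_hook_sets_mult) (use assms N in auto)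
  moreover have "(t - l - 2) div 2 = N" "(t - l) div 2 = Suc N"
    using N by auto
  moreover have "(subset_sum_fps (hook_sets t (2 * m + 1) l) :: 'a fps) =
      subset_sum_fps (hook_sets t (2 * m + 1) l) * ?Q * inverse ?Q"
    by (simp only: mult.assoc inverse_mult_eq_1'[OF Q] mult_1_right)
  ultimately show ?thesis
    using Q by (simp add: fps_divide_unit power_add mult_ac)
qed

section \<open>Summation over all columns and legs\<close>

text \<open>The term \<open>f m\<close> has no coefficients below index \<open>m\<close>, so the
  series converges coefficientwise and the terms with \<open>m > n\<close> affect no coefficient up
  to \<open>n\<close>, hence not coefficient \<open>n\<close> of the product with
  \<open>c\<close>.\<close>

lemma mult_suminf_fps_nth:
  fixes c :: "'a::comm_ring_1 fps" and f :: "nat \<Rightarrow> 'a fps"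
  assumes "\<And>m n. n < m \<Longrightarrow> f m $ n = 0"
  shows "(c * suminf f) $ n = (\<Sum>m<Suc n. (c * f m) $ n)"
proof -
  have partial: "(\<Sum>m<M. f m $ n) = (\<Sum>m<Suc n. f m $ n)" if "n < M" for M n
    using that assms by (intro sum.mono_neutral_right) auto
  have "f sums Abs_fps (\<lambda>n. \<Sum>m<Suc n. f m $ n)"
    unfolding sums_def
  proof (rule tendsto_fpsI)
    fix n
    show "eventually (\<lambda>M. (\<Sum>m<M. f m) $ n = Abs_fps (\<lambda>n. \<Sum>m<Suc n. f m $ n) $ n) sequentially"
      using eventually_gt_at_top[of n]
      by eventually_elim (simp only: fps_sum_nth fps_nth_Abs_fps, rule partial)
  qed
  then have nth: "suminf f $ i = (\<Sum>m<Suc n. f m $ i)" if "i \<le> n" for i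
    using that partial[of i "Suc n"] by (simp add: sums_iff del: sum.lessThan_Suc)
  have "(c * suminf f) $ n = (c * (\<Sum>m<Suc n. f m)) $ n"
    by (simp add: fps_mult_nth fps_sum_nth nth del: sum.lessThan_Suc)
  then show ?thesis
    by (simp add: sum_distrib_left fps_sum_nth del: sum.lessThan_Suc)
qed

lemma fps_X_power_divide_nth_eq_0:
  fixes g :: "'a::field fps"
  assumes "g $ 0 \<noteq> 0" "n < k"
  shows "(fps_X ^ k / g) $ n = 0"
  using assms by (simp add: fps_divide_unit fps_X_power_mult_nth)

lemma sum_lessThan_double:
  fixes n :: nat
  shows "(\<Sum>j<2 * n. f j :: 'a::comm_monoid_add) = (\<Sum>m<n. f (2 * m)) + (\<Sum>m<n. f (2 * m + 1))"
  by (induction n) (simp_all add: ac_simps)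

text \<open>This is the theorem indexed by the leg length, before splitting by the parity of
  \<open>t\<close>. The ranges come from the binomials: \<open>l \<le> (t - l - 1) div 2\<close>
  amounts to \<open>3 * l + 1 \<le> t\<close> when \<open>t - l\<close> is odd, and similarly
  \<open>3 * l + 2 \<le> t\<close> when it is even.\<close>

lemma B_star_eq:
  "B_star t =
    q_poch_inf (- fps_X) (fps_X ^ 2) *
      (\<Sum>l | 3 * l + 1 \<le> t \<and> odd (t - l).
        fps_X ^ (t + l * (l - 1)) * q_binom ((t - l - 1) div 2) l (fps_X ^ 2) *
        (\<Sum>m. fps_X ^ (2 * m * (l + 1)) /
           q_poch (- (fps_X ^ (2 * m + 1))) (fps_X ^ 2) ((t - l + 1) div 2))) +
    q_poch_inf (- fps_X) (fps_X ^ 2) *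
      (\<Sum>l | 3 * l + 2 \<le> t \<and> even (t - l).
        fps_X ^ (t + l * (l + 1) + 1) * q_binom ((t - l - 2) div 2) l (fps_X ^ 2) *
        (\<Sum>m. fps_X ^ (2 * m * (l + 1)) /
           q_poch (- (fps_X ^ (2 * m + 3))) (fps_X ^ 2) ((t - l) div 2)))"
proof -
  let ?P = "q_poch_inf (- fps_X) (fps_X ^ 2) :: rat fps"
  let ?a = "\<lambda>l. fps_X ^ (t + l * (l - 1)) * q_binom ((t - l - 1) div 2) l (fps_X ^ 2) :: rat fps"
  let ?b = "\<lambda>l. fps_X ^ (t + l * (l + 1) + 1) * q_binom ((t - l - 2) div 2) l (fps_X ^ 2) :: rat fps"
  let ?f = "\<lambda>l m. fps_X ^ (2 * m * (l + 1)) /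
      q_poch (- (fps_X ^ (2 * m + 1))) (fps_X ^ 2) ((t - l + 1) div 2) :: rat fps"
  let ?g = "\<lambda>l m. fps_X ^ (2 * m * (l + 1)) /
      q_poch (- (fps_X ^ (2 * m + 3))) (fps_X ^ 2) ((t - l) div 2) :: rat fps"
  let ?h = "\<lambda>l. if odd (t - l) then ?P * ?a l * suminf (?f l) else ?P * ?b l * suminf (?g l)"
  have small: "?f l m $ n = 0" "?g l m $ n = 0" if "n < m" for l m n
  proof -
    have "n < 2 * m * (l + 1)"
      using that by (simp add: trans_less_add2)
    then show "?f l m $ n = 0" "?g l m $ n = 0"
      by (intro fps_X_power_divide_nth_eq_0 q_poch_X_nth_0_neq; simp)+
  qed
  \<comment> \<open>The bound \<open>2 * Suc n\<close> gives \<open>Suc n\<close> columns of each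
    parity, matching the \<open>Suc n\<close> terms of the series that reach coefficient
    \<open>n\<close>. One parity of columns contributes nothing, as the part
    \<open>j + (t - l)\<close> would be even.\<close>
  have hook_sum: "(\<Sum>j<2 * Suc n. subset_sum_fps (hook_sets t j l) $ n) = ?h l $ n" if "l < t" for l n
  proof -
    have split: "(\<Sum>j<2 * Suc n. subset_sum_fps (hook_sets t j l) $ n) =
        (\<Sum>m<Suc n. subset_sum_fps (hook_sets t (2 * m) l) $ n) +
        (\<Sum>m<Suc n. subset_sum_fps (hook_sets t (2 * m + 1) l) $ n :: rat)"
      by (rule sum_lessThan_double)
    show ?thesis
    proof (cases "odd (t - l)")
      case True
      have "hook_sets t (2 * m + 1) l = {}" for m
        using True by (intro hook_sets_empty) simp
      then have "(\<Sum>j<2 * Suc n. subset_sum_fps (hook_sets t j l) $ n) =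
          (\<Sum>m<Suc n. (?P * ?a l * ?f l m) $ n)"
        unfolding split subset_sum_fps_hook_sets_even_column[OF that True]
        by (simp add: subset_sum_fps_def)
      also have "\<dots> = (?P * ?a l * suminf (?f l)) $ n"
        by (rule mult_suminf_fps_nth[symmetric]) (rule small)
      finally show ?thesis
        using True by simp
    next
      case False
      then have even: "even (t - l)" by simp
      have "hook_sets t (2 * m) l = {}" for m
        using even by (intro hook_sets_empty) simp
      then have "(\<Sum>j<2 * Suc n. subset_sum_fps (hook_sets t j l) $ n) =
          (\<Sum>m<Suc n. (?P * ?b l * ?g l m) $ n)"
        unfolding split subset_sum_fps_hook_sets_odd_column[OF that even]
        by (simp add: subset_sum_fps_def)
      also have "\<dots> = (?P * ?b l * suminf (?g l)) $ n"
        by (rule mult_suminf_fps_nth[symmetric]) (rule small)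
      finally show ?thesis
        using False by simp
    qed
  qed
  have "B_star t = (\<Sum>l<t. ?h l)"
  proof (rule fps_ext)
    fix n
    \<comment> \<open>At \<open>n = 0\<close> the series has coefficient 0 by definition;
      \<open>b_star t 0\<close> is 0 too, by the column bound \<open>M = 0\<close>.\<close>
    have "B_star t $ n = of_nat (b_star t n)"
      using b_star_eq_sum_hook_sets[of 0 0 t] by (cases n) (simp_all add: B_star_def)
    also have "\<dots> = (\<Sum>l<t. \<Sum>j<2 * Suc n. subset_sum_fps (hook_sets t j l) $ n)"
      by (subst b_star_eq_sum_hook_sets[of n "2 * Suc n"], simp)
        (simp add: subset_sum_fps_def del: sum.lessThan_Suc mult_Suc_right)
    also have "\<dots> = (\<Sum>l<t. ?h l) $ n"
      unfolding fps_sum_nth by (intro sum.cong refl hook_sum) simp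
    finally show "B_star t $ n = (\<Sum>l<t. ?h l) $ n" .
  qed
  also have "\<dots> = (\<Sum>l | l < t \<and> odd (t - l). ?P * ?a l * suminf (?f l)) +
      (\<Sum>l | l < t \<and> even (t - l). ?P * ?b l * suminf (?g l))"
    by (subst sum.If_cases) (auto simp: Int_def intro!: arg_cong2[where f = "(+)"] sum.cong)
  also have "(\<Sum>l | l < t \<and> odd (t - l). ?P * ?a l * suminf (?f l)) =
      (\<Sum>l | 3 * l + 1 \<le> t \<and> odd (t - l). ?P * ?a l * suminf (?f l))"
    by (rule sum.mono_neutral_right) (auto intro!: q_binom_eq_0)
  also have "(\<Sum>l | l < t \<and> even (t - l). ?P * ?b l * suminf (?g l)) =
      (\<Sum>l | 3 * l + 2 \<le> t \<and> even (t - l). ?P * ?b l * suminf (?g l))"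
  proof (rule sum.mono_neutral_right)
    show "\<forall>l\<in>{l. l < t \<and> even (t - l)} - {l. 3 * l + 2 \<le> t \<and> even (t - l)}.
        ?P * ?b l * suminf (?g l) = 0"
    proof
      fix l assume "l \<in> {l. l < t \<and> even (t - l)} - {l. 3 * l + 2 \<le> t \<and> even (t - l)}"
      then have "l < t" "even (t - l)" "\<not> 3 * l + 2 \<le> t"
        by auto
      \<comment> \<open>Evenness of \<open>t - l\<close> excludes \<open>t = Suc l\<close>, so
        \<open>t - l - 2\<close> is a true difference.\<close>
      then have "t - l - 2 < l * 2"
        by (cases "t = Suc l") auto
      then have "(t - l - 2) div 2 < l"
        by (rule less_mult_imp_div_less)
      then have "q_binom ((t - l - 2) div 2) l (fps_X ^ 2) = (0 :: rat fps)"
        by (rule q_binom_eq_0)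
      then show "?P * ?b l * suminf (?g l) = 0"
        by (simp only: mult_zero_left mult_zero_right)
    qed
  qed auto
  finally show ?thesis
    by (simp add: sum_distrib_left mult.assoc)
qed

section \<open>Floor bounds and the split by the parity of \<open>t\<close>\<close>

text \<open>The quotient is real, so for \<open>t < r\<close> the floor is negative and both sets
  are empty, as the convention on empty sums requires.\<close>

lemma le_floor_div_6_set: "{k::nat. int k \<le> \<lfloor>(real t - real r) / 6\<rfloor>} = {k. 6 * k + r \<le> t}"
proof -
  have "int k \<le> \<lfloor>(real t - real r) / 6\<rfloor> \<longleftrightarrow> real (6 * k + r) \<le> real t" for k
    by (auto simp: le_floor_iff field_simps)
  then show ?thesis
    by (simp only: of_nat_le_iff)
qed

theorem theorem2p2:
  fixes t :: nat and q :: "rat fps"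
  assumes "t \<ge> 1"
  defines "q \<equiv> fps_X"
  shows
    "(even t \<longrightarrow>
       B_star t =
         q_poch_inf (- q) (q ^ 2) *
           (\<Sum>k \<in> {k::nat. int k \<le> \<lfloor>(real t - 4) / 6\<rfloor>}.
              q ^ (t + 4 * k ^ 2 + 2 * k) * q_binom ((t - 2 * k - 2) div 2) (2 * k + 1) (q ^ 2) *
              (\<Sum>m. q ^ (2 * m * (2 * k + 2)) /
                     q_poch (- (q ^ (2 * m + 1))) (q ^ 2) ((t - 2 * k) div 2)))
       + q_poch_inf (- q) (q ^ 2) *
           (\<Sum>k \<in> {k::nat. int k \<le> \<lfloor>(real t - 2) / 6\<rfloor>}.
              q ^ (t + 4 * k ^ 2 + 2 * k + 1) * q_binom ((t - 2 * k - 2) div 2) (2 * k) (q ^ 2) *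
              (\<Sum>m. q ^ (2 * m * (2 * k + 1)) /
                     q_poch (- (q ^ (2 * m + 3))) (q ^ 2) ((t - 2 * k) div 2))))
   \<and> (odd t \<longrightarrow>
       B_star t =
         q_poch_inf (- q) (q ^ 2) *
           (\<Sum>k \<in> {k::nat. int k \<le> \<lfloor>(real t - 1) / 6\<rfloor>}.
              q ^ (t + 4 * k ^ 2 - 2 * k) * q_binom ((t - 2 * k - 1) div 2) (2 * k) (q ^ 2) *
              (\<Sum>m. q ^ (2 * m * (2 * k + 1)) /
                     q_poch (- (q ^ (2 * m + 1))) (q ^ 2) ((t - 2 * k + 1) div 2)))
       + q_poch_inf (- q) (q ^ 2) *
           (\<Sum>k \<in> {k::nat. int k \<le> \<lfloor>(real t - 5) / 6\<rfloor>}.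
              q ^ (t + 4 * k ^ 2 + 6 * k + 3) * q_binom ((t - 2 * k - 3) div 2) (2 * k + 1) (q ^ 2) *
              (\<Sum>m. q ^ (2 * m * (2 * k + 2)) /
                     q_poch (- (q ^ (2 * m + 3))) (q ^ 2) ((t - 2 * k - 1) div 2))))"
proof -
  note floors = le_floor_div_6_set[of t 1] le_floor_div_6_set[of t 2]
    le_floor_div_6_set[of t 4] le_floor_div_6_set[of t 5]
  note floors = floors[unfolded of_nat_numeral of_nat_1]
  let ?u = "\<lambda>l. fps_X ^ (t + l * (l - 1)) * q_binom ((t - l - 1) div 2) l (fps_X ^ 2) *
      (\<Sum>m. fps_X ^ (2 * m * (l + 1)) /
         q_poch (- (fps_X ^ (2 * m + 1))) (fps_X ^ 2) ((t - l + 1) div 2)) :: rat fps"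
  let ?v = "\<lambda>l. fps_X ^ (t + l * (l + 1) + 1) * q_binom ((t - l - 2) div 2) l (fps_X ^ 2) *
      (\<Sum>m. fps_X ^ (2 * m * (l + 1)) /
         q_poch (- (fps_X ^ (2 * m + 3))) (fps_X ^ 2) ((t - l) div 2)) :: rat fps"
  show ?thesis
  proof (intro conjI impI)
    assume t: "even t"
    \<comment> \<open>For even \<open>t\<close>, even columns have odd legs
      \<open>l = 2 * k + 1\<close>, and \<open>3 * l + 1\<close> becomes \<open>6 * k + 4\<close>;
      odd columns have even legs.\<close>
    have "(\<Sum>l | 3 * l + 1 \<le> t \<and> odd (t - l). ?u l) = (\<Sum>k | 6 * k + 4 \<le> t. ?u (2 * k + 1))"
      using t by (intro sum.reindex_bij_witness[of _ "\<lambda>k. 2 * k + 1" "\<lambda>l. l div 2"])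
        (auto elim!: oddE evenE)
    also have "\<dots> = (\<Sum>k | 6 * k + 4 \<le> t.
        fps_X ^ (t + 4 * k ^ 2 + 2 * k) * q_binom ((t - 2 * k - 2) div 2) (2 * k + 1) (fps_X ^ 2) *
        (\<Sum>m. fps_X ^ (2 * m * (2 * k + 2)) /
           q_poch (- (fps_X ^ (2 * m + 1))) (fps_X ^ 2) ((t - 2 * k) div 2)))"
    proof (rule sum.cong)
      fix k assume "k \<in> {k. 6 * k + 4 \<le> t}"
      \<comment> \<open>The second equation needs \<open>2 * k + 1 \<le> t\<close> under truncated
        subtraction, which the range of \<open>k\<close> supplies.\<close>
      then have eqs: "t - (2 * k + 1) - 1 = t - 2 * k - 2" "t - (2 * k + 1) + 1 = t - 2 * k"
        "t + (2 * k + 1) * (2 * k + 1 - 1) = t + 4 * k ^ 2 + 2 * k" "2 * k + 1 + 1 = 2 * k + 2"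
        by (auto simp: power2_eq_square algebra_simps)
      show "?u (2 * k + 1) = fps_X ^ (t + 4 * k ^ 2 + 2 * k) *
          q_binom ((t - 2 * k - 2) div 2) (2 * k + 1) (fps_X ^ 2) *
          (\<Sum>m. fps_X ^ (2 * m * (2 * k + 2)) /
             q_poch (- (fps_X ^ (2 * m + 1))) (fps_X ^ 2) ((t - 2 * k) div 2))"
        unfolding eqs ..
    qed simp
    finally have U: "(\<Sum>l | 3 * l + 1 \<le> t \<and> odd (t - l). ?u l) = \<dots>" .
    have "(\<Sum>l | 3 * l + 2 \<le> t \<and> even (t - l). ?v l) = (\<Sum>k | 6 * k + 2 \<le> t. ?v (2 * k))"
      using t by (intro sum.reindex_bij_witness[of _ "\<lambda>k. 2 * k" "\<lambda>l. l div 2"])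
        (auto elim!: oddE evenE)
    also have "\<dots> = (\<Sum>k | 6 * k + 2 \<le> t.
        fps_X ^ (t + 4 * k ^ 2 + 2 * k + 1) * q_binom ((t - 2 * k - 2) div 2) (2 * k) (fps_X ^ 2) *
        (\<Sum>m. fps_X ^ (2 * m * (2 * k + 1)) /
           q_poch (- (fps_X ^ (2 * m + 3))) (fps_X ^ 2) ((t - 2 * k) div 2)))"
    proof (rule sum.cong)
      fix k :: nat
      have eqs: "t + (2 * k) * (2 * k + 1) + 1 = t + 4 * k ^ 2 + 2 * k + 1"
        by (auto simp: power2_eq_square algebra_simps)
      show "?v (2 * k) = fps_X ^ (t + 4 * k ^ 2 + 2 * k + 1) *
          q_binom ((t - 2 * k - 2) div 2) (2 * k) (fps_X ^ 2) *
          (\<Sum>m. fps_X ^ (2 * m * (2 * k + 1)) /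
             q_poch (- (fps_X ^ (2 * m + 3))) (fps_X ^ 2) ((t - 2 * k) div 2))"
        unfolding eqs ..
    qed simp
    finally show "B_star t = q_poch_inf (- q) (q ^ 2) *
           (\<Sum>k \<in> {k::nat. int k \<le> \<lfloor>(real t - 4) / 6\<rfloor>}.
              q ^ (t + 4 * k ^ 2 + 2 * k) * q_binom ((t - 2 * k - 2) div 2) (2 * k + 1) (q ^ 2) *
              (\<Sum>m. q ^ (2 * m * (2 * k + 2)) /
                     q_poch (- (q ^ (2 * m + 1))) (q ^ 2) ((t - 2 * k) div 2)))
       + q_poch_inf (- q) (q ^ 2) *
           (\<Sum>k \<in> {k::nat. int k \<le> \<lfloor>(real t - 2) / 6\<rfloor>}.
              q ^ (t + 4 * k ^ 2 + 2 * k + 1) * q_binom ((t - 2 * k - 2) div 2) (2 * k) (q ^ 2) *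
              (\<Sum>m. q ^ (2 * m * (2 * k + 1)) /
                     q_poch (- (q ^ (2 * m + 3))) (q ^ 2) ((t - 2 * k) div 2)))"
      unfolding q_def floors B_star_eq[of t] U by (simp only:)
  next
    assume t: "odd t"
    \<comment> \<open>For odd \<open>t\<close> the roles swap: even columns have legs
      \<open>2 * k\<close> and odd columns legs \<open>2 * k + 1\<close>, where
      \<open>3 * l + 2\<close> becomes \<open>6 * k + 5\<close>.\<close>
    have "(\<Sum>l | 3 * l + 1 \<le> t \<and> odd (t - l). ?u l) = (\<Sum>k | 6 * k + 1 \<le> t. ?u (2 * k))"
      using t by (intro sum.reindex_bij_witness[of _ "\<lambda>k. 2 * k" "\<lambda>l. l div 2"])
        (auto elim!: oddE evenE)
    also have "\<dots> = (\<Sum>k | 6 * k + 1 \<le> t.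
        fps_X ^ (t + 4 * k ^ 2 - 2 * k) * q_binom ((t - 2 * k - 1) div 2) (2 * k) (fps_X ^ 2) *
        (\<Sum>m. fps_X ^ (2 * m * (2 * k + 1)) /
           q_poch (- (fps_X ^ (2 * m + 1))) (fps_X ^ 2) ((t - 2 * k + 1) div 2)))"
    proof (rule sum.cong)
      fix k :: nat
      \<comment> \<open>At \<open>k = 0\<close> the truncated \<open>2 * k - 1\<close> is multiplied
        by 0; otherwise neither subtraction truncates.\<close>
      have eqs: "t + (2 * k) * (2 * k - 1) = t + 4 * k ^ 2 - 2 * k"
        by (cases k) (auto simp: power2_eq_square algebra_simps)
      show "?u (2 * k) = fps_X ^ (t + 4 * k ^ 2 - 2 * k) *
          q_binom ((t - 2 * k - 1) div 2) (2 * k) (fps_X ^ 2) *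
          (\<Sum>m. fps_X ^ (2 * m * (2 * k + 1)) /
             q_poch (- (fps_X ^ (2 * m + 1))) (fps_X ^ 2) ((t - 2 * k + 1) div 2))"
        unfolding eqs ..
    qed simp
    finally have U: "(\<Sum>l | 3 * l + 1 \<le> t \<and> odd (t - l). ?u l) = \<dots>" .
    have "(\<Sum>l | 3 * l + 2 \<le> t \<and> even (t - l). ?v l) = (\<Sum>k | 6 * k + 5 \<le> t. ?v (2 * k + 1))"
      using t by (intro sum.reindex_bij_witness[of _ "\<lambda>k. 2 * k + 1" "\<lambda>l. l div 2"])
        (auto elim!: oddE evenE)
    also have "\<dots> = (\<Sum>k | 6 * k + 5 \<le> t.
        fps_X ^ (t + 4 * k ^ 2 + 6 * k + 3) * q_binom ((t - 2 * k - 3) div 2) (2 * k + 1) (fps_X ^ 2) *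
        (\<Sum>m. fps_X ^ (2 * m * (2 * k + 2)) /
           q_poch (- (fps_X ^ (2 * m + 3))) (fps_X ^ 2) ((t - 2 * k - 1) div 2)))"
    proof (rule sum.cong)
      fix k :: nat
      have eqs: "t - (2 * k + 1) = t - 2 * k - 1" "t - 2 * k - 1 - 2 = t - 2 * k - 3"
        "t + (2 * k + 1) * (2 * k + 2) + 1 = t + 4 * k ^ 2 + 6 * k + 3" "2 * k + 1 + 1 = 2 * k + 2"
        by (auto simp: power2_eq_square algebra_simps)
      show "?v (2 * k + 1) = fps_X ^ (t + 4 * k ^ 2 + 6 * k + 3) *
          q_binom ((t - 2 * k - 3) div 2) (2 * k + 1) (fps_X ^ 2) *
          (\<Sum>m. fps_X ^ (2 * m * (2 * k + 2)) /
             q_poch (- (fps_X ^ (2 * m + 3))) (fps_X ^ 2) ((t - 2 * k - 1) div 2))"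
        unfolding eqs ..
    qed simp
    finally show "B_star t = q_poch_inf (- q) (q ^ 2) *
           (\<Sum>k \<in> {k::nat. int k \<le> \<lfloor>(real t - 1) / 6\<rfloor>}.
              q ^ (t + 4 * k ^ 2 - 2 * k) * q_binom ((t - 2 * k - 1) div 2) (2 * k) (q ^ 2) *
              (\<Sum>m. q ^ (2 * m * (2 * k + 1)) /
                     q_poch (- (q ^ (2 * m + 1))) (q ^ 2) ((t - 2 * k + 1) div 2)))
       + q_poch_inf (- q) (q ^ 2) *
           (\<Sum>k \<in> {k::nat. int k \<le> \<lfloor>(real t - 5) / 6\<rfloor>}.
              q ^ (t + 4 * k ^ 2 + 6 * k + 3) * q_binom ((t - 2 * k - 3) div 2) (2 * k + 1) (q ^ 2) *
              (\<Sum>m. q ^ (2 * m * (2 * k + 2)) /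
                     q_poch (- (q ^ (2 * m + 3))) (q ^ 2) ((t - 2 * k - 1) div 2)))"
      unfolding q_def floors B_star_eq[of t] U by (simp only:)
  qed
qed

end
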